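(* Let $q$ be a prime power and let $n\geq 2$ be an integer. There is a bijection between the set $\mathcal{D}(n)$ of distance vectors for the full flag variety on $\mathbb{F}_q^n$ and the set $\mathcal{M}_n$ of Motzkin paths of length $n$.
   Context: Let $\mathbb{F}_q$ be the finite field with $q$ elements. A full flag on $\mathbb{F}_q^n$ is a sequence $\mathcal{F}=(\mathcal{F}_1,\dots,\mathcal{F}_{n-1})$ of $\mathbb{F}_q$-subspaces of $\mathbb{F}_q^n$ with $\mathcal{F}_1\subsetneq\cdots\subsetneq\mathcal{F}_{n-1}$ and $\dim \mathcal{F}_i=i$ for every $i$; the set of all full flags is the full flag variety $\mathcal{F}_q(n)$. For subspaces $\mathcal{U},\mathcal{V}$ of the same dimension $k$, the injection distance is $d_I(\mathcal{U},\mathcal{V})=k-\dim(\mathcal{U}\cap\mathcal{V})$. The distance vector of $\mathcal{F},\mathcal{F}'\in\mathcal{F}_q(n)$ is $\mathbf{d}(\mathcal{F},\mathcal{F}')=(d_I(\mathcal{F}_1,\mathcal{F}'_1),\dots,d_I(\mathcal{F}_{n-1},\mathcal{F}'_{n-1}))\in\mathbb{Z}^{n-1}$, and $\mathcal{D}(n)=\{\mathbf{d}(\mathcal{F},\mathcal{F}') \mid \mathcal{F},\mathcal{F}'\in\mathcal{F}_q(n)\}$ (pairs with $\mathcal{F}=\mathcal{F}'$ are allowed, so the zero vector belongs to $\mathcal{D}(n)$). A Motzkin path of length $n$ is a lattice path in $\mathbb{Z}^2$ from $(0,0)$ to $(n,0)$ with steps $U=(1,1)$, $D=(1,-1)$,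 $H=(1,0)$ that never runs below the $x$-axis; $\mathcal{M}_n$ is the set of these. It is identified with its Motzkin word $p_1p_2\dots p_n$ in the letters $U,D,H$. *)

theory Defs
  imports "HOL-Analysis.Analysis" "HOL-Number_Theory.Prime_Powers"
begin

text \<open>
  The space \<open>'k ^ 'n\<close> with \<open>'k\<close> a finite field plays the role of $F_q^n$, where $q$ is
  \<open>CARD('k)\<close> and $n$ is \<open>CARD('n)\<close>. Linear algebra over an arbitrary field is the
  library's \<open>vec\<close> interpretation of \<open>vector_space\<close>; the unqualified \<open>subspace\<close> and \<open>dim\<close>
  are about real scalars only.
\<close>

text \<open>Lists are indexed from 0, so \<open>F ! i\<close> is the member of dimension \<open>i + 1\<close>.\<close>

definition full_flags :: "(('k::field) ^ 'n) set list set" where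
  "full_flags =
    {F. length F = CARD('n) - 1 \<and>
        (\<forall>i < length F. vec.subspace (F ! i) \<and> vec.dim (F ! i) = i + 1) \<and>
        (\<forall>i. i + 1 < length F \<longrightarrow> F ! i \<subset> F ! (i + 1))}"

definition injection_distance :: "(('k::field) ^ 'n) set \<Rightarrow> ('k ^ 'n) set \<Rightarrow> int" where
  "injection_distance U V = int (vec.dim U) - int (vec.dim (U \<inter> V))"

definition distance_vector :: "(('k::field) ^ 'n) set list \<Rightarrow> ('k ^ 'n) set list \<Rightarrow> int list" where
  "distance_vector F F' = map2 injection_distance F F'"

definition distance_vectors :: "('k::field) itself \<Rightarrow> 'n::finite itself \<Rightarrow> int list set" where
  "distance_vectors _ _ =
    {distance_vector F F' | F F'. F \<in> (full_flags :: ('k ^ 'n) set list set) \<and> F' \<in> full_flags}"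

datatype motzkin_step = Up | Down | Horizontal

fun step_vector :: "motzkin_step \<Rightarrow> int \<times> int" where
  "step_vector Up = (1, 1)"
| "step_vector Down = (1, -1)"
| "step_vector Horizontal = (1, 0)"

text \<open>
  A path starting at the origin is given by its word of steps. Every step advances the first
  coordinate by 1, so ending at \<open>(int n, 0)\<close> forces the word to have length \<open>n\<close>.
\<close>

definition path_point :: "motzkin_step list \<Rightarrow> nat \<Rightarrow> int \<times> int" where
  "path_point w k = sum_list (map step_vector (take k w))"

definition motzkin_paths :: "nat \<Rightarrow> motzkin_step list set" where
  "motzkin_paths n =
    {w. path_point w (length w) = (int n, 0) \<and> (\<forall>k \<le> length w. snd (path_point w k) \<ge> 0)}"

end

theory Submission imports Defs begin

text \<open>
  Heights identify a Motzkin path of length \<open>n\<close> with a nonnegative sequence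
  \<open>h 0, \<dots>, h n\<close> that vanishes at both ends and moves by at most 1. Passing from index \<open>i\<close> to
  \<open>i + 1\<close> in two flags raises the dimension of the intersection by 0, 1 or 2, so
  distance vectors are such sequences. Conversely, every such sequence arises from two flags of
  coordinate subspaces, that is, from two growing chains \<open>A\<close>, \<open>B\<close> of index sets: a rise adds two
  different fresh indices to \<open>A\<close> and to \<open>B\<close>, a level step adds one fresh index to both, and a
  descent adds to each set an index that so far belongs only to the other.
\<close>

definition motzkin_heights :: "nat \<Rightarrow> (nat \<Rightarrow> int) \<Rightarrow> bool" where
  "motzkin_heights n h \<longleftrightarrow>
    h 0 = 0 \<and> h n = 0 \<and> (\<forall>i\<le>n. 0 \<le> h i) \<and> (\<forall>i<n. \<bar>h (Suc i) - h i\<bar> \<le> 1)"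

text \<open>Going backwards from the final height 0, each step gains at most 1. The bound later
  guarantees enough fresh indices for the index chains.\<close>

lemma motzkin_heights_le_remaining:
  assumes "motzkin_heights n h" "i \<le> n"
  shows "h i \<le> int n - int i"
  using \<open>i \<le> n\<close>
proof (induction i rule: inc_induct)
  case base
  then show ?case using assms(1) by (simp add: motzkin_heights_def)
next
  case (step i)
  have "\<bar>h (Suc i) - h i\<bar> \<le> 1"
    using assms(1) step.hyps by (simp add: motzkin_heights_def)
  with step.IH show ?case by simp
qed

subsection \<open>Motzkin words and their heights\<close>

definition path_height :: "motzkin_step list \<Rightarrow> nat \<Rightarrow> int" where
  "path_height w k = snd (path_point w k)"

text \<open>Inverse of the vertical part of a step; the default \<open>Horizontal\<close> is meant
  for difference 0.\<close>

fun step_of_difference :: "int \<Rightarrow> motzkin_step" where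
  "step_of_difference d = (if d = 1 then Up else if d = -1 then Down else Horizontal)"

lemma step_of_difference_snd [simp]: "step_of_difference (snd (step_vector s)) = s"
  by (cases s) auto

lemma snd_step_of_difference: "\<bar>d\<bar> \<le> 1 \<Longrightarrow> snd (step_vector (step_of_difference d)) = d"
  by auto

lemma path_point_Suc:
  "k < length w \<Longrightarrow> path_point w (Suc k) = path_point w k + step_vector (w ! k)"
  by (simp add: path_point_def take_Suc_conv_app_nth)

lemma path_height_0 [simp]: "path_height w 0 = 0"
  by (simp add: path_height_def path_point_def)

lemma path_height_Suc:
  "k < length w \<Longrightarrow> path_height w (Suc k) = path_height w k + snd (step_vector (w ! k))"
  by (simp add: path_height_def path_point_Suc)

lemma fst_path_point: "k \<le> length w \<Longrightarrow> fst (path_point w k) = int k"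
proof (induction k)
  case 0
  then show ?case by (simp add: path_point_def)
next
  case (Suc k)
  then show ?case by (cases "w ! k") (simp_all add: path_point_Suc)
qed

text \<open>The first coordinate counts steps, so the endpoint condition splits into the length and
  the final height. The bound on height differences holds for every word.\<close>

lemma motzkin_paths_iff:
  "w \<in> motzkin_paths n \<longleftrightarrow> length w = n \<and> motzkin_heights n (path_height w)"
proof -
  have "\<bar>path_height w (Suc k) - path_height w k\<bar> \<le> 1" if "k < length w" for k
    using that by (cases "w ! k") (simp_all add: path_height_Suc)
  then show ?thesis
    using fst_path_point[of "length w" w]
    by (auto simp: motzkin_paths_def motzkin_heights_def path_height_def[symmetric] prod_eq_iff)
qed

lemma path_height_eq_imp_eq:
  assumes "length w = length w'" "\<And>k. k \<le> length w \<Longrightarrow> path_height w k = path_height w' k"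
  shows "w = w'"
proof (rule nth_equalityI[OF assms(1)])
  fix k assume k: "k < length w"
  then have "snd (step_vector (w ! k)) = snd (step_vector (w' ! k))"
    using assms(1) assms(2)[of k] assms(2)[of "Suc k"] by (simp add: path_height_Suc)
  then show "w ! k = w' ! k"
    by (metis step_of_difference_snd)
qed

lemma motzkin_path_of_heights:
  assumes "motzkin_heights n h"
  obtains w where "w \<in> motzkin_paths n" "\<And>k. k \<le> n \<Longrightarrow> path_height w k = h k"
proof -
  define w where "w = map (\<lambda>i. step_of_difference (h (Suc i) - h i)) [0..<n]"
  have height: "path_height w k = h k" if "k \<le> n" for k
    using that
  proof (induction k)
    case 0
    then show ?case using assms by (simp add: motzkin_heights_def)
  next
    case (Suc k)
    then have "\<bar>h (Suc k) - h k\<bar> \<le> 1"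
      using assms by (simp add: motzkin_heights_def)
    with Suc show ?case
      by (simp add: path_height_Suc w_def snd_step_of_difference del: step_of_difference.simps)
  qed
  then have "motzkin_heights n (path_height w)"
    using assms by (simp add: motzkin_heights_def)
  then have "w \<in> motzkin_paths n"
    by (simp add: motzkin_paths_iff w_def)
  with height that show thesis by blast
qed

text \<open>The distance vector omits the heights at \<open>0\<close> and \<open>n\<close>, which are always 0.\<close>

definition inner_heights :: "nat \<Rightarrow> (nat \<Rightarrow> int) \<Rightarrow> int list" where
  "inner_heights n h = map (\<lambda>i. h (Suc i)) [0..<n - 1]"

lemma inner_heights_cong:
  "(\<And>i. i \<le> n \<Longrightarrow> h i = h' i) \<Longrightarrow> inner_heights n h = inner_heights n h'"
  by (simp add: inner_heights_def)

text \<open>Nothing is lost by dropping the two end values, since both are fixed at 0.\<close>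

lemma inner_heights_eqD:
  assumes "inner_heights n h = inner_heights n h'" "motzkin_heights n h" "motzkin_heights n h'"
    "i \<le> n"
  shows "h i = h' i"
proof (cases "i = 0 \<or> i = n")
  case True
  with assms(2,3) show ?thesis by (auto simp: motzkin_heights_def)
next
  case False
  with \<open>i \<le> n\<close> obtain j where "i = Suc j" "j < n - 1"
    by (cases i) auto
  with assms(1) show ?thesis
    by (auto simp: inner_heights_def)
qed

text \<open>This is the combinatorial half: the target is the set that will turn out to be the set
  of distance vectors.\<close>

lemma bij_betw_inner_heights:
  "bij_betw (\<lambda>w. inner_heights n (path_height w)) (motzkin_paths n)
     (inner_heights n ` Collect (motzkin_heights n))"
  unfolding bij_betw_def
proof
  show "inj_on (\<lambda>w. inner_heights n (path_height w)) (motzkin_paths n)"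
  proof (rule inj_onI)
    fix w w' assume w: "w \<in> motzkin_paths n" "w' \<in> motzkin_paths n"
      "inner_heights n (path_height w) = inner_heights n (path_height w')"
    then have "path_height w k = path_height w' k" if "k \<le> n" for k
      using inner_heights_eqD that by (metis motzkin_paths_iff)
    with w(1,2) show "w = w'"
      by (intro path_height_eq_imp_eq) (auto simp: motzkin_paths_iff)
  qed
  show "(\<lambda>w. inner_heights n (path_height w)) ` motzkin_paths n =
    inner_heights n ` Collect (motzkin_heights n)"
  proof
    show "(\<lambda>w. inner_heights n (path_height w)) ` motzkin_paths n \<subseteq>
      inner_heights n ` Collect (motzkin_heights n)"
      by (auto simp: motzkin_paths_iff)
    show "inner_heights n ` Collect (motzkin_heights n) \<subseteq>
      (\<lambda>w. inner_heights n (path_height w)) ` motzkin_paths n"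
    proof clarify
      fix h assume "motzkin_heights n h"
      then obtain w where w: "w \<in> motzkin_paths n" "\<And>k. k \<le> n \<Longrightarrow> path_height w k = h k"
        using motzkin_path_of_heights by blast
      then have "inner_heights n h = inner_heights n (path_height w)"
        by (intro inner_heights_cong) simp
      with w(1) show "inner_heights n h \<in> (\<lambda>w. inner_heights n (path_height w)) ` motzkin_paths n"
        by blast
    qed
  qed
qed

subsection \<open>Distance vectors are height sequences\<close>

text \<open>The dimension formula for the sum of \<open>W \<inter> U'\<close> and \<open>U\<close>:
  this sum lies in \<open>U'\<close>, and the two spaces meet in
  \<open>W \<inter> U\<close>.\<close>

lemma dim_inter_extend_le:
  fixes U U' W :: "('k::field ^ 'n) set"
  assumes "vec.subspace U" "vec.subspace U'" "vec.subspace W" "U \<subseteq> U'"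
  shows "vec.dim (W \<inter> U') + vec.dim U \<le> vec.dim (W \<inter> U) + vec.dim U'"
proof -
  have sub: "vec.subspace (W \<inter> U')"
    using assms by (simp add: vec.subspace_inter)
  have "{x + y | x y. x \<in> W \<inter> U' \<and> y \<in> U} \<subseteq> U'"
    using assms by (auto intro: vec.subspace_add)
  then have "vec.dim {x + y | x y. x \<in> W \<inter> U' \<and> y \<in> U} \<le> vec.dim U'"
    by (rule vec.dim_subset)
  moreover have "W \<inter> U' \<inter> U = W \<inter> U"
    using assms(4) by blast
  ultimately show ?thesis
    using vec.dim_sums_Int[OF sub assms(1)] by simp
qed

text \<open>Pads the flag with the zero space and the whole space, so that the index is the
  dimension up to \<open>CARD('n)\<close> and the end heights need no separate treatment.\<close>

definition flag_space :: "('k::field ^ 'n) set list \<Rightarrow> nat \<Rightarrow> ('k ^ 'n) set" where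
  "flag_space F i = (if i = 0 then {0} else if i \<le> length F then F ! (i - 1) else UNIV)"

context
  fixes F :: "('k::field ^ 'n) set list"
  assumes F: "F \<in> full_flags"
begin

lemma length_full_flag: "length F = CARD('n) - 1"
  using F by (simp add: full_flags_def)

lemma subspace_flag_space: "vec.subspace (flag_space F i)"
  using F by (auto simp: full_flags_def flag_space_def vec.subspace_0)

lemma dim_flag_space: "i \<le> CARD('n) \<Longrightarrow> vec.dim (flag_space F i) = i"
  using F by (auto simp: full_flags_def flag_space_def card_cart_basis)

lemma flag_space_mono: "flag_space F i \<subseteq> flag_space F (Suc i)"
proof -
  have "F ! (i - 1) \<subseteq> F ! i" if "i \<noteq> 0" "Suc i \<le> length F"
  proof -
    have "(i - 1) + 1 < length F" using that by simp
    then have "F ! (i - 1) \<subset> F ! ((i - 1) + 1)"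
      using F unfolding full_flags_def by blast
    with that show ?thesis by auto
  qed
  \<comment> \<open>This settles \<open>i = 0\<close>, where the smaller space is
    \<open>{0}\<close>.\<close>
  moreover have "0 \<in> flag_space F (Suc i)"
    using subspace_flag_space by (rule vec.subspace_0)
  ultimately show ?thesis by (auto simp: flag_space_def)
qed

end

lemma distance_vector_is_heights:
  fixes F F' :: "('k::field ^ 'n) set list"
  assumes F: "F \<in> full_flags" and F': "F' \<in> full_flags"
  shows "distance_vector F F' \<in> inner_heights CARD('n) ` Collect (motzkin_heights CARD('n))"
proof
  define c where "c i = vec.dim (flag_space F i \<inter> flag_space F' i)" for i
  define h where "h i = int i - int (c i)" for i
  have len: "length F = CARD('n) - 1" "length F' = CARD('n) - 1"
    using F F' by (simp_all add: length_full_flag)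
  show "distance_vector F F' = inner_heights CARD('n) h"
  proof (rule nth_equalityI)
    show "length (distance_vector F F') = length (inner_heights CARD('n) h)"
      by (simp add: distance_vector_def inner_heights_def len)
    fix i assume "i < length (distance_vector F F')"
    then have i: "i < CARD('n) - 1"
      by (simp add: distance_vector_def len)
    then have "F ! i = flag_space F (Suc i)" "F' ! i = flag_space F' (Suc i)"
      by (simp_all add: flag_space_def len)
    with i show "distance_vector F F' ! i = inner_heights CARD('n) h ! i"
      by (simp add: distance_vector_def inner_heights_def len injection_distance_def
          h_def c_def dim_flag_space[OF F])
  qed
  have c_le: "c i \<le> i" if "i \<le> CARD('n)" for i
    using vec.dim_subset[of "flag_space F i \<inter> flag_space F' i" "flag_space F i"] that
    by (simp add: c_def dim_flag_space[OF F])
  \<comment> \<open>Subtraction is truncated, so positivity of \<open>CARD('n)\<close> is what makes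
    index \<open>CARD('n)\<close> fall under the default \<open>UNIV\<close> in both flags.\<close>
  have "\<not> CARD('n) \<le> CARD('n) - 1"
    using zero_less_card_finite[where 'a = 'n] by linarith
  then have c_n: "c CARD('n) = CARD('n)"
    by (simp add: c_def flag_space_def len card_cart_basis)
  have c_step: "c i \<le> c (Suc i) \<and> c (Suc i) \<le> c i + 2" if "i < CARD('n)" for i
  proof
    let ?E = "flag_space F" and ?E' = "flag_space F'"
    note sub = subspace_flag_space[OF F] subspace_flag_space[OF F']
      and mono = flag_space_mono[OF F, of i] flag_space_mono[OF F', of i]
    show "c i \<le> c (Suc i)"
      unfolding c_def using mono by (intro vec.dim_subset) blast
    \<comment> \<open>Only one flag advances at a time, passing through the mixed intersection; each
      advance costs at most 1.\<close>
    have "vec.dim (?E (Suc i) \<inter> ?E' (Suc i)) \<le> vec.dim (?E (Suc i) \<inter> ?E' i) + 1"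
      using dim_inter_extend_le[of "?E' i" "?E' (Suc i)" "?E (Suc i)"] sub mono that
      by (simp add: dim_flag_space[OF F'])
    moreover have "vec.dim (?E' i \<inter> ?E (Suc i)) \<le> vec.dim (?E' i \<inter> ?E i) + 1"
      using dim_inter_extend_le[of "?E i" "?E (Suc i)" "?E' i"] sub mono that
      by (simp add: dim_flag_space[OF F])
    ultimately show "c (Suc i) \<le> c i + 2"
      by (simp add: c_def Int_commute)
  qed
  have "\<bar>h (Suc i) - h i\<bar> \<le> 1" if "i < CARD('n)" for i
    using c_step[OF that] by (auto simp: h_def)
  then show "h \<in> Collect (motzkin_heights CARD('n))"
    using c_le[of 0] c_le c_n by (simp add: motzkin_heights_def h_def)
qed

subsection \<open>Height sequences are distance vectors\<close>

text \<open>Outside \<open>A \<union> B\<close> there are \<open>CARD('n) - i - d\<close> indices.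
  The upper bound on \<open>e\<close> leaves two of them for a rise and one for a level step, while
  \<open>0 \<le> e\<close> forces \<open>d \<ge> 1\<close> for a descent.\<close>

lemma index_chains_extend:
  fixes A B :: "'n::finite set"
  assumes AB: "card A = i" "card B = i" and d: "int (card (A - B)) = d"
    and e: "0 \<le> e" "\<bar>e - d\<bar> \<le> 1" "e \<le> int CARD('n) - int (Suc i)"
  obtains A' B' where "card A' = Suc i" "card B' = Suc i" "int (card (A' - B')) = e"
    "A \<subseteq> A'" "B \<subseteq> B'"
proof -
  have Un: "int (card (A \<union> B)) = int i + d"
    using card_Un_disjoint[of "A - B" B] AB d by (simp add: Diff_Int_distrib2)
  have compl: "int (card (- (A \<union> B))) = int CARD('n) - int i - d"
    using Un card_mono[of UNIV "A \<union> B"] by (simp add: Compl_eq_Diff_UNIV card_Diff_subset)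
  \<comment> \<open>Needed for a descent, which takes one index from each of the two
    differences.\<close>
  have BA: "card (B - A) = card (A - B)"
    using AB by (simp add: card_Diff_subset_Int Int_commute)
  consider (rise) "e = d + 1" | (level) "e = d" | (descent) "e = d - 1"
    using e(2) by linarith
  then show thesis
  proof cases
    case rise
    then have "2 \<le> card (- (A \<union> B))"
      using compl e(3) by simp
    then obtain T where "T \<subseteq> - (A \<union> B)" "card T = 2"
      by (meson obtain_subset_with_card_n)
    then obtain x y where xy: "x \<noteq> y" "x \<notin> A \<union> B" "y \<notin> A \<union> B"
      by (auto simp: card_2_iff)
    then have "insert x A - insert y B = insert x (A - B)"
      by auto
    with xy AB d rise show thesis
      by (intro that[of "insert x A" "insert y B"]) auto
  next
    case level
    then have "- (A \<union> B) \<noteq> {}"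
      using compl e(3) by force
    then obtain x where x: "x \<notin> A \<union> B"
      by blast
    then have "insert x A - insert x B = A - B"
      by auto
    with x AB d level show thesis
      by (intro that[of "insert x A" "insert x B"]) auto
  next
    case descent
    then have pos: "card (A - B) > 0"
      using d e(1) by linarith
    then have "A - B \<noteq> {}" "B - A \<noteq> {}"
      using BA by (metis card.empty less_irrefl)+
    then obtain x y where xy: "x \<in> B - A" "y \<in> A - B"
      by blast
    then have "insert x A - insert y B = (A - B) - {y}"
      by auto
    with xy have "int (card (insert x A - insert y B)) = e"
      using pos d descent by (simp add: of_nat_diff)
    with xy AB show thesis
      by (intro that[of "insert x A" "insert y B"]) auto
  qed
qed

lemma index_chains_exist:
  assumes h: "motzkin_heights CARD('n::finite) h"
  obtains A B :: "nat \<Rightarrow> 'n::finite set"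
  where "\<And>i. i \<le> CARD('n) \<Longrightarrow> card (A i) = i" "\<And>i. i \<le> CARD('n) \<Longrightarrow> card (B i) = i"
    "\<And>i. i \<le> CARD('n) \<Longrightarrow> int (card (A i - B i)) = h i"
    "\<And>i. i < CARD('n) \<Longrightarrow> A i \<subseteq> A (Suc i)" "\<And>i. i < CARD('n) \<Longrightarrow> B i \<subseteq> B (Suc i)"
proof -
  \<comment> \<open>Dependent choice yields an infinite sequence; the guards in \<open>P\<close> and
    \<open>Q\<close> make all demands beyond \<open>CARD('n)\<close> vacuous.\<close>
  define P :: "nat \<Rightarrow> 'n set \<times> 'n set \<Rightarrow> bool" where
    "P i = (\<lambda>(A, B). i \<le> CARD('n) \<longrightarrow>
       card A = i \<and> card B = i \<and> int (card (A - B)) = h i)" for i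
  define Q :: "nat \<Rightarrow> 'n set \<times> 'n set \<Rightarrow> 'n set \<times> 'n set \<Rightarrow> bool" where
    "Q i = (\<lambda>(A, B) (A', B'). i < CARD('n) \<longrightarrow> A \<subseteq> A' \<and> B \<subseteq> B')" for i
  have "\<exists>f. \<forall>i. P i (f i) \<and> Q i (f i) (f (Suc i))"
  proof (rule dependent_nat_choice)
    show "\<exists>x. P 0 x"
      using h by (auto simp: P_def motzkin_heights_def)
  next
    fix x i assume "P i x"
    obtain A B where x: "x = (A, B)" by (cases x)
    show "\<exists>y. P (Suc i) y \<and> Q i x y"
    proof (cases "i < CARD('n)")
      case True
      have "0 \<le> h (Suc i)" "\<bar>h (Suc i) - h i\<bar> \<le> 1" "h (Suc i) \<le> int CARD('n) - int (Suc i)"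
        using h True motzkin_heights_le_remaining[OF h, of "Suc i"]
        by (auto simp: motzkin_heights_def)
      moreover have "card A = i" "card B = i" "int (card (A - B)) = h i"
        using \<open>P i x\<close> True by (simp_all add: P_def x)
      ultimately obtain A' B' where "card A' = Suc i" "card B' = Suc i"
        "int (card (A' - B')) = h (Suc i)" "A \<subseteq> A'" "B \<subseteq> B'"
        using index_chains_extend by metis
      then have "P (Suc i) (A', B') \<and> Q i x (A', B')"
        by (simp add: P_def Q_def x)
      then show ?thesis ..
    next
      case False
      then show ?thesis by (simp add: P_def Q_def case_prod_unfold)
    qed
  qed
  then obtain f where f: "\<And>i. P i (f i)" "\<And>i. Q i (f i) (f (Suc i))"
    by blast
  show thesis
    by (rule that[of "\<lambda>i. fst (f i)" "\<lambda>i. snd (f i)"])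
      (use f in \<open>auto simp: P_def Q_def case_prod_unfold\<close>)
qed

text \<open>The span of the standard basis vectors indexed by \<open>S\<close>. Dimensions and
  intersections of such spaces reduce to cardinalities and intersections of index sets.\<close>

definition coordinate_subspace :: "'n::finite set \<Rightarrow> ('k::field ^ 'n) set" where
  "coordinate_subspace S = {x. \<forall>i. i \<notin> S \<longrightarrow> x $ i = 0}"

lemma subspace_coordinate_subspace: "vec.subspace (coordinate_subspace S)"
  by (simp add: coordinate_subspace_def subspace_substandard_cart)

lemma dim_coordinate_subspace: "vec.dim (coordinate_subspace S) = card S"
  by (simp add: coordinate_subspace_def dim_substandard_cart)

lemma coordinate_subspace_Int:
  "coordinate_subspace S \<inter> coordinate_subspace T = coordinate_subspace (S \<inter> T)"
  by (auto simp: coordinate_subspace_def)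

lemma coordinate_subspace_mono: "S \<subseteq> T \<Longrightarrow> coordinate_subspace S \<subseteq> coordinate_subspace T"
  by (auto simp: coordinate_subspace_def)

lemma coordinate_flag:
  fixes A :: "nat \<Rightarrow> 'n::finite set"
  assumes "\<And>i. i \<le> CARD('n) \<Longrightarrow> card (A i) = i" "\<And>i. i < CARD('n) \<Longrightarrow> A i \<subseteq> A (Suc i)"
  shows "map (\<lambda>i. coordinate_subspace (A (Suc i)) :: ('k::field ^ 'n) set) [0..<CARD('n) - 1]
    \<in> full_flags"
proof -
  have "coordinate_subspace (A i) \<subset> (coordinate_subspace (A (Suc i)) :: ('k ^ 'n) set)"
    if "i < CARD('n)" for i
  proof
    show "coordinate_subspace (A i) \<subseteq> (coordinate_subspace (A (Suc i)) :: ('k ^ 'n) set)"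
      using assms(2)[OF that] by (rule coordinate_subspace_mono)
    \<comment> \<open>Strictness of the inclusion follows from the different dimensions
      \<open>i\<close> and \<open>Suc i\<close>.\<close>
    have "vec.dim (coordinate_subspace (A i) :: ('k ^ 'n) set) \<noteq>
        vec.dim (coordinate_subspace (A (Suc i)) :: ('k ^ 'n) set)"
      using assms(1)[of i] assms(1)[of "Suc i"] that by (simp add: dim_coordinate_subspace)
    then show "coordinate_subspace (A i) \<noteq> (coordinate_subspace (A (Suc i)) :: ('k ^ 'n) set)"
      by metis
  qed
  then show ?thesis
    by (auto simp: full_flags_def subspace_coordinate_subspace dim_coordinate_subspace assms(1))
qed

lemma heights_are_distance_vector:
  assumes h: "motzkin_heights CARD('n::finite) h"
  shows "inner_heights CARD('n) h \<in> distance_vectors TYPE('k::field) TYPE('n)"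
proof -
  obtain A B :: "nat \<Rightarrow> 'n set"
    where A: "\<And>i. i \<le> CARD('n) \<Longrightarrow> card (A i) = i" "\<And>i. i < CARD('n) \<Longrightarrow> A i \<subseteq> A (Suc i)"
      and B: "\<And>i. i \<le> CARD('n) \<Longrightarrow> card (B i) = i" "\<And>i. i < CARD('n) \<Longrightarrow> B i \<subseteq> B (Suc i)"
      and AB: "\<And>i. i \<le> CARD('n) \<Longrightarrow> int (card (A i - B i)) = h i"
    using index_chains_exist[OF h] by metis
  define flag where "flag C =
    map (\<lambda>i. coordinate_subspace (C (Suc i)) :: ('k ^ 'n) set) [0..<CARD('n) - 1]" for C
  have "injection_distance (coordinate_subspace (A i) :: ('k ^ 'n) set)
      (coordinate_subspace (B i)) = h i" if "i \<le> CARD('n)" for i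
  proof -
    \<comment> \<open>The injection distance is \<open>card (A i) - card (A i \<inter> B i)\<close>,
      hence the size of \<open>A i - B i\<close>.\<close>
    have "card (A i) = card (A i - B i) + card (A i \<inter> B i)"
      by (metis add.commute card_Int_Diff finite)
    with AB[OF that] show ?thesis
      by (simp add: injection_distance_def coordinate_subspace_Int dim_coordinate_subspace)
  qed
  then have "inner_heights CARD('n) h = distance_vector (flag A) (flag B)"
    by (auto simp: flag_def distance_vector_def inner_heights_def intro!: nth_equalityI)
  moreover have "flag A \<in> full_flags"
    unfolding flag_def by (rule coordinate_flag) (fact A)+
  moreover have "flag B \<in> full_flags"
    unfolding flag_def by (rule coordinate_flag) (fact B)+
  ultimately show ?thesis
    unfolding distance_vectors_def by blast
qed

lemma distance_vectors_eq_heights: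
  "distance_vectors TYPE('k::field) TYPE('n::finite) =
    inner_heights CARD('n) ` Collect (motzkin_heights CARD('n))"
proof
  show "distance_vectors TYPE('k) TYPE('n) \<subseteq>
      inner_heights CARD('n) ` Collect (motzkin_heights CARD('n))"
    unfolding distance_vectors_def using distance_vector_is_heights by blast
  show "inner_heights CARD('n) ` Collect (motzkin_heights CARD('n)) \<subseteq>
      distance_vectors TYPE('k) TYPE('n)"
    using heights_are_distance_vector by blast
qed

theorem theorem4p2:
  fixes q n :: nat
  assumes "primepow q"
    and "CARD('k::{field,finite}) = q"
    and "n \<ge> 2"
    and "CARD('n::finite) = n"
  shows "\<exists>f. bij_betw f (distance_vectors TYPE('k) TYPE('n)) (motzkin_paths n)"
  \<comment> \<open>The explicit bijection sends a word to its inner heights, so the wanted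
    \<open>f\<close> is its inverse.\<close>
  using bij_betw_inv[OF bij_betw_inner_heights[of n]] assms(4)
  by (simp add: distance_vectors_eq_heights)

end
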